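(* Let $n\ge2$. For any $\rho\ge0$, the subdivision scheme $\mathcal{S}=\{S_k\}_{k\in\mathbb{N}_0}$ with parameter $\rho$ defined in the context belongs to class B.
   Context: Notation: $\mathbb{N}_0=\{0,1,2,\ldots\}$, $\mathbb{N}=\{1,2,\ldots\}$; $\ell_\infty(\mathbb{Z},\mathbb{R}^n)$ is the set of bounded sequences $f=(f_i)_{i\in\mathbb{Z}}$, $f_i\in\mathbb{R}^n$; $\nabla f_i:=f_{i+1}-f_i$; $|\cdot|_2$ is the Euclidean norm. For $a=(a_j)$ real and $b=(b_j)$ with $b_j\in\mathbb{R}^m$, of equal finite length, $\langle a,b\rangle:=\sum_j a_jb_j\in\mathbb{R}^m$. Lagrange rules. For $\alpha,\beta\in(0,+\infty)$ let $$a_{-1}(\alpha,\beta)=-\frac{3(4\beta+3)}{64(\alpha^2+\alpha)(\alpha+\beta+1)},\quad a_0(\alpha,\beta)=\frac{3(4\alpha+1)(4\beta+3)}{64\alpha(\beta+1)},$$ $$a_1(\alpha,\beta)=\frac{(4\alpha+1)(4\beta+3)}{64\beta(\alpha+1)},\quad a_2(\alpha,\beta)=-\frac{3(4\alpha+1)}{64(\beta^2+\beta)(\alpha+\beta+1)},$$ $$\Lambda_0[\alpha,\beta](f_{-1},f_0,f_1,f_2)=\sum_{j=-1}^2 a_j(\alpha,\beta)f_j,\qquad \Lambda_1[\alpha,\beta](f_{-1},f_0,f_1,f_2)=\sum_{j=-1}^2 a_{1-j}(\beta,\alpha)f_j .$$ The scheme with parameter $\rho\ge0$. For $A,B>0$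 and $k\in\mathbb{N}_0$ let $$\alpha^k(A,B)=\max\left\{(1+2^{-k}\rho)^{-1},\min\left\{1+2^{-k}\rho,\ \frac{1}{A+\frac{\sqrt{A(A+1)B(B+1)}}{B+1}}\right\}\right\},\qquad \beta^k(A,B)=\alpha^k(B,A).$$ For column vectors $\delta_{-1},\delta_0,\delta_1\in\mathbb{R}^n$ let $$\mathrm{num}=\det\begin{pmatrix}\delta_{-1}^T\delta_0&\delta_{-1}^T\delta_1\\ \delta_1^T\delta_0&|\delta_1|_2^2\end{pmatrix},\qquad \mathrm{den}=\det\begin{pmatrix}|\delta_{-1}|_2^2&\delta_{-1}^T\delta_1\\ \delta_{-1}^T\delta_1&|\delta_1|_2^2\end{pmatrix},$$ $A(\delta_{-1},\delta_0,\delta_1)=\tfrac12$ if $\mathrm{num}\cdot\mathrm{den}=0$ and $A(\delta_{-1},\delta_0,\delta_1)=|\mathrm{num}/\mathrm{den}|$ otherwise; $B(\delta_{-1},\delta_0,\delta_1)=A(\delta_1,\delta_0,\delta_{-1})$. For $l=0,1$ put $$\Psi^k_l(f_{-1},f_0,f_1,f_2)=\Lambda_l[\bar\alpha,\bar\beta](f_{-1},f_0,f_1,f_2),$$ where $\bar\alpha=\alpha^k(\bar A,\bar B)$, $\bar\beta=\beta^k(\bar A,\bar B)$, $\bar A=A(\nabla f_{-1},\nabla f_0,\nabla f_1)$, $\bar B=B(\nabla f_{-1},\nabla f_0,\nabla f_1)$. The subdivision operators are $(S_kf)_{2i+l}=\Psi^k_l(f_{i-1},f_i,f_{i+1},f_{i+2})$,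 $l=0,1$, $i\in\mathbb{Z}$, and $\mathcal{S}=\{S_k\}_{k\in\mathbb{N}_0}$. Uniform schemes: a uniform subdivision scheme is a sequence $\{S_k\}_{k\in\mathbb{N}_0}$ of operators on $\ell_\infty(\mathbb{Z},\mathbb{R}^n)$ of the form $(S_kf)_{2i+l}=\Psi^k_l(f_{i-p},\ldots,f_{i+p+1})$, $l=0,1$, $i\in\mathbb{Z}$, for some $p\in\mathbb{N}_0$ and $\Psi^k_0,\Psi^k_1:(\mathbb{R}^n)^{2p+2}\to\mathbb{R}^n$; it is linear if all $\Psi^k_l$ are linear and stationary if the $\Psi^k_l$ do not depend on $k$. Convergence: $\{f^k\}$ converges uniformly to a continuous $G:\mathbb{R}\to\mathbb{R}^n$ iff for every compact interval $I\subset\mathbb{R}$, $\lim_{k\to\infty}\sup_{i\in\mathbb{Z}\cap2^kI}|f^k_i-G(i2^{-k})|=0$. A scheme is convergent iff for every $f^0\in\ell_\infty(\mathbb{Z},\mathbb{R}^n)$ the sequence $f^{k+1}=S_kf^k$ converges uniformly to a continuous function $S^\infty f^0$, and $S^\infty\ne0$. Class B: a scheme belongs to class B iff it is uniform and there exist $q\in\mathbb{N}$, $D\subset\mathbb{R}^q$ with $0\in D$, maps $\pi_k:(\mathbb{R}^n)^{2p+2}\to D$ ($k\in\mathbb{N}_0$), $\vec\Lambda_0,\vec\Lambda_1:D\to\mathbb{R}^{2p+2}$ and constants $\rho',C>0$ such that, for some norms $|\cdot|_{\mathbb{R}^q},|\cdot|_{\mathbb{R}^{2p+2}}$, for $l=0,1$,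 all $k\in\mathbb{N}_0$ and all $f_{-p},\ldots,f_{p+1}\in\mathbb{R}^n$, $$\Psi^k_l(f_{-p},\ldots,f_{p+1})=\langle\vec\Lambda_l(\pi_k(f_{-p},\ldots,f_{p+1})),(f_{-p},\ldots,f_{p+1})\rangle,$$ $$|\pi_k(f_{-p},\ldots,f_{p+1})|_{\mathbb{R}^q}\le2^{-k}\rho',\qquad|\vec\Lambda_l(\pi)-\vec\Lambda_l(0)|_{\mathbb{R}^{2p+2}}\le C|\pi|_{\mathbb{R}^q}\ \ \forall\pi\in D;$$ moreover it is required that the linear uniform stationary scheme with rules $\Psi^*_l(f_{-p},\ldots,f_{p+1})=\langle\vec\Lambda_l(0),(f_{-p},\ldots,f_{p+1})\rangle$, $l=0,1$, is convergent. *)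

theory Defs
  imports "HOL-Analysis.Analysis"
begin

definition ell_infty :: "(int \<Rightarrow> real^'n) set" where
  "ell_infty = {f. bounded (range f)}"

text \<open>The spaces \<open>(\<real>\<^sup>n)\<^sup>2\<^sup>p\<^sup>+\<^sup>2\<close> and \<open>\<real>\<^sup>2\<^sup>p\<^sup>+\<^sup>2\<close> are the extensional functions
  \<open>window p \<rightarrow>\<^sub>E UNIV\<close>, with components indexed by \<open>-p, \<dots>, p+1\<close>; likewise \<open>\<real>\<^sup>q\<close> is
  \<open>{1..q} \<rightarrow>\<^sub>E UNIV\<close>, since \<open>p\<close> and \<open>q\<close> are quantified inside the definitions below.\<close>

definition window :: "nat \<Rightarrow> int set" where
  "window p = {- int p .. int p + 1}"

definition norm_on :: "'i set \<Rightarrow> (('i \<Rightarrow> real) \<Rightarrow> real) \<Rightarrow> bool" where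
  "norm_on I N \<longleftrightarrow>
     (\<forall>x \<in> I \<rightarrow>\<^sub>E UNIV. 0 \<le> N x \<and> (N x = 0 \<longleftrightarrow> x = (\<lambda>i\<in>I. 0))) \<and>
     (\<forall>c. \<forall>x \<in> I \<rightarrow>\<^sub>E UNIV. N (\<lambda>i\<in>I. c * x i) = \<bar>c\<bar> * N x) \<and>
     (\<forall>x \<in> I \<rightarrow>\<^sub>E UNIV. \<forall>y \<in> I \<rightarrow>\<^sub>E UNIV. N (\<lambda>i\<in>I. x i + y i) \<le> N x + N y)"

text \<open>The operator with rules \<open>\<psi> 0\<close>, \<open>\<psi> 1\<close>; lemma \<open>uniform_op_rule\<close> gives the usual form.\<close>

definition uniform_op ::
  "nat \<Rightarrow> (nat \<Rightarrow> (int \<Rightarrow> real^'n) \<Rightarrow> real^'n) \<Rightarrow> (int \<Rightarrow> real^'n) \<Rightarrow> int \<Rightarrow> real^'n" where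
  "uniform_op p \<psi> f m = \<psi> (nat (m mod 2)) (\<lambda>j\<in>window p. f (m div 2 + j))"

lemma uniform_op_rule:
  assumes "l \<in> {0, 1}"
  shows "uniform_op p \<psi> f (2 * i + int l) = \<psi> l (\<lambda>j\<in>window p. f (i + j))"
  using assms by (auto simp: uniform_op_def)

definition uniform_scheme ::
  "nat \<Rightarrow> (nat \<Rightarrow> nat \<Rightarrow> (int \<Rightarrow> real^'n) \<Rightarrow> real^'n) \<Rightarrow>
   (nat \<Rightarrow> (int \<Rightarrow> real^'n) \<Rightarrow> int \<Rightarrow> real^'n) \<Rightarrow> bool" where
  "uniform_scheme p \<Psi> S \<longleftrightarrow>
     (\<forall>k. \<forall>f\<in>ell_infty. S k f \<in> ell_infty \<and> S k f = uniform_op p (\<Psi> k) f)"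

primrec iterates ::
  "(nat \<Rightarrow> (int \<Rightarrow> real^'n) \<Rightarrow> int \<Rightarrow> real^'n) \<Rightarrow> (int \<Rightarrow> real^'n) \<Rightarrow> nat \<Rightarrow> int \<Rightarrow> real^'n" where
  "iterates S f0 0 = f0"
| "iterates S f0 (Suc k) = S k (iterates S f0 k)"

text \<open>The supremum is taken in \<open>ennreal\<close>, so that it is \<open>0\<close> when no integer lies in \<open>2\<^sup>k I\<close>.\<close>

definition converges_uniformly_to :: "(nat \<Rightarrow> int \<Rightarrow> real^'n) \<Rightarrow> (real \<Rightarrow> real^'n) \<Rightarrow> bool" where
  "converges_uniformly_to f G \<longleftrightarrow>
     (\<forall>a b. (\<lambda>k. SUP i \<in> {i. real_of_int i \<in> (\<lambda>x. 2 ^ k * x) ` {a..b}}.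
                    ennreal (norm (f k i - G (real_of_int i / 2 ^ k)))) \<longlonglongrightarrow> 0)"

definition convergent_scheme :: "(nat \<Rightarrow> (int \<Rightarrow> real^'n) \<Rightarrow> int \<Rightarrow> real^'n) \<Rightarrow> bool" where
  "convergent_scheme S \<longleftrightarrow>
     (\<exists>Sinf.
        (\<forall>f0\<in>ell_infty. continuous_on UNIV (Sinf f0) \<and>
                         converges_uniformly_to (iterates S f0) (Sinf f0)) \<and>
        (\<exists>f0\<in>ell_infty. Sinf f0 \<noteq> (\<lambda>x. 0)))"

definition pairing :: "nat \<Rightarrow> (int \<Rightarrow> real) \<Rightarrow> (int \<Rightarrow> real^'n) \<Rightarrow> real^'n" where
  "pairing p a b = (\<Sum>j\<in>window p. a j *\<^sub>R b j)"

definition class_B :: "(nat \<Rightarrow> (int \<Rightarrow> real^'n) \<Rightarrow> int \<Rightarrow> real^'n) \<Rightarrow> bool" where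
  "class_B S \<longleftrightarrow>
     (\<exists>p \<Psi>. uniform_scheme p \<Psi> S \<and>
       (\<exists>(q::nat) D \<pi> \<Lambda> (\<rho>'::real) (C::real) N M.
          q \<ge> 1 \<and> D \<subseteq> {1..q} \<rightarrow>\<^sub>E UNIV \<and> (\<lambda>i\<in>{1..q}. 0) \<in> D \<and>
          (\<forall>k. \<pi> k \<in> (window p \<rightarrow>\<^sub>E UNIV) \<rightarrow> D) \<and>
          (\<forall>l\<in>{0, 1}. \<Lambda> l \<in> D \<rightarrow> (window p \<rightarrow>\<^sub>E UNIV)) \<and>
          \<rho>' > 0 \<and> C > 0 \<and> norm_on {1..q} N \<and> norm_on (window p) M \<and>
          (\<forall>l\<in>{0, 1}. \<forall>k. \<forall>f \<in> window p \<rightarrow>\<^sub>E UNIV. \<Psi> k l f = pairing p (\<Lambda> l (\<pi> k f)) f) \<and>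
          (\<forall>k. \<forall>f \<in> window p \<rightarrow>\<^sub>E UNIV. N (\<pi> k f) \<le> (1/2) ^ k * \<rho>') \<and>
          (\<forall>l\<in>{0, 1}. \<forall>x\<in>D.
             M (\<lambda>j\<in>window p. \<Lambda> l x j - \<Lambda> l (\<lambda>i\<in>{1..q}. 0) j) \<le> C * N x) \<and>
          convergent_scheme
            (\<lambda>k. uniform_op p (\<lambda>l. pairing p (\<Lambda> l (\<lambda>i\<in>{1..q}. 0)))
                 :: (int \<Rightarrow> real^'n) \<Rightarrow> int \<Rightarrow> real^'n)))"

definition lagrange_coeff :: "real \<Rightarrow> real \<Rightarrow> int \<Rightarrow> real" where
  "lagrange_coeff \<alpha> \<beta> j =
     (if j = -1 then - (3 * (4 * \<beta> + 3)) / (64 * (\<alpha>\<^sup>2 + \<alpha>) * (\<alpha> + \<beta> + 1))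
      else if j = 0 then (3 * (4 * \<alpha> + 1) * (4 * \<beta> + 3)) / (64 * \<alpha> * (\<beta> + 1))
      else if j = 1 then ((4 * \<alpha> + 1) * (4 * \<beta> + 3)) / (64 * \<beta> * (\<alpha> + 1))
      else if j = 2 then - (3 * (4 * \<alpha> + 1)) / (64 * (\<beta>\<^sup>2 + \<beta>) * (\<alpha> + \<beta> + 1))
      else 0)"

definition lagrange_rule :: "nat \<Rightarrow> real \<Rightarrow> real \<Rightarrow> (int \<Rightarrow> real^'n) \<Rightarrow> real^'n" where
  "lagrange_rule l \<alpha> \<beta> f =
     (if l = 0 then (\<Sum>j = -1..2. lagrange_coeff \<alpha> \<beta> j *\<^sub>R f j)
      else (\<Sum>j = -1..2. lagrange_coeff \<beta> \<alpha> (1 - j) *\<^sub>R f j))"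

definition alpha :: "real \<Rightarrow> nat \<Rightarrow> real \<Rightarrow> real \<Rightarrow> real" where
  "alpha \<rho> k A B =
     max (inverse (1 + (1/2) ^ k * \<rho>))
         (min (1 + (1/2) ^ k * \<rho>)
              (1 / (A + sqrt (A * (A + 1) * B * (B + 1)) / (B + 1))))"

definition beta :: "real \<Rightarrow> nat \<Rightarrow> real \<Rightarrow> real \<Rightarrow> real" where
  "beta \<rho> k A B = alpha \<rho> k B A"

definition num :: "real^'n \<Rightarrow> real^'n \<Rightarrow> real^'n \<Rightarrow> real" where
  "num d d0 d1 =
     det (vector [vector [d \<bullet> d0, d \<bullet> d1],
                  vector [d1 \<bullet> d0, (norm d1)\<^sup>2]] :: real^2^2)"

definition den :: "real^'n \<Rightarrow> real^'n \<Rightarrow> real^'n \<Rightarrow> real" where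
  "den d d0 d1 =
     det (vector [vector [(norm d)\<^sup>2, d \<bullet> d1],
                  vector [d \<bullet> d1, (norm d1)\<^sup>2]] :: real^2^2)"

definition coeff_A :: "real^'n \<Rightarrow> real^'n \<Rightarrow> real^'n \<Rightarrow> real" where
  "coeff_A d d0 d1 =
     (if num d d0 d1 * den d d0 d1 = 0 then 1/2 else \<bar>num d d0 d1 / den d d0 d1\<bar>)"

definition coeff_B :: "real^'n \<Rightarrow> real^'n \<Rightarrow> real^'n \<Rightarrow> real" where
  "coeff_B d d0 d1 = coeff_A d1 d0 d"

definition nabla :: "(int \<Rightarrow> real^'n) \<Rightarrow> int \<Rightarrow> real^'n" where
  "nabla f i = f (i + 1) - f i"

definition geom_rule :: "real \<Rightarrow> nat \<Rightarrow> nat \<Rightarrow> (int \<Rightarrow> real^'n) \<Rightarrow> real^'n" where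
  "geom_rule \<rho> k l f =
     (let A = coeff_A (nabla f (-1)) (nabla f 0) (nabla f 1);
          B = coeff_B (nabla f (-1)) (nabla f 0) (nabla f 1)
      in lagrange_rule l (alpha \<rho> k A B) (beta \<rho> k A B) f)"

definition geom_scheme :: "real \<Rightarrow> nat \<Rightarrow> (int \<Rightarrow> real^'n) \<Rightarrow> int \<Rightarrow> real^'n" where
  "geom_scheme \<rho> k = uniform_op 1 (geom_rule \<rho> k)"

end

theory Submission
  imports Defs
begin

text \<open>The tension parameters \<open>\<alpha>\<^sup>k - 1\<close> and \<open>\<beta>\<^sup>k - 1\<close> are clamped to size \<open>2\<^sup>-\<^sup>k \<rho>\<close>, and the Lagrange
  coefficients are rational functions of \<open>\<alpha>, \<beta>\<close> without poles on \<open>[1/(1+\<rho>), 1+\<rho>]\<^sup>2\<close>, hence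
  Lipschitz at \<open>(1,1)\<close> there. At \<open>(1,1)\<close> the scheme is the dual four-point scheme with weights
  \<open>(-7, 105, 35, -5)/128\<close> and their mirror image. Its difference scheme has the weights
  \<open>(-2, 68, -2)/128\<close> and \<open>(-5, 37, 37, -5)/128\<close>, so one step contracts differences by
  \<open>84/128\<close>, which gives convergence.\<close>

section \<open>Convergence of schemes contracting differences\<close>

text \<open>The increments are dominated by a geometric series. Its tail beyond \<open>k\<close>
  sums to \<open>c * \<mu> ^ k / (1 - \<mu>)\<close>, which gives an explicit rate of
  convergence.\<close>

lemma geometric_increments_limit:
  fixes s :: "nat \<Rightarrow> 'a::banach"
  assumes "0 \<le> \<mu>" "\<mu> < 1" and inc: "\<And>k. norm (s (Suc k) - s k) \<le> c * \<mu> ^ k"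
  shows "s \<longlonglongrightarrow> lim s" "norm (s k - lim s) \<le> c * \<mu> ^ k / (1 - \<mu>)"
proof -
  have geo: "summable (\<lambda>n. c * \<mu> ^ n)"
    using assms by (intro summable_mult summable_geometric) auto
  have "summable (\<lambda>n. s (Suc n) - s n)"
    by (rule summable_comparison_test[OF _ geo]) (use inc in auto)
  then have "convergent (\<lambda>n. \<Sum>i<n. s (Suc i) - s i)"
    by (simp add: summable_iff_convergent)
  then obtain L where "(\<lambda>n. s n - s 0) \<longlonglongrightarrow> L"
    by (auto simp: convergent_def sum_lessThan_telescope)
  then have "(\<lambda>n. (s n - s 0) + s 0) \<longlonglongrightarrow> L + s 0"
    by (intro tendsto_intros)
  then have "convergent s"
    by (auto simp: convergent_def)
  then show lim: "s \<longlonglongrightarrow> lim s"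
    by (simp add: convergent_LIMSEQ_iff)
  have bound: "norm (s (k + n) - s k) \<le> c * \<mu> ^ k / (1 - \<mu>)" for n
  proof -
    have c0: "0 \<le> c"
      using order_trans[OF norm_ge_zero inc[of 0]] by simp
    \<comment> \<open>The closed form of the finite geometric sum is what the induction needs; the
      factor \<open>1 - \<mu> ^ n\<close> is bounded by 1 afterwards.\<close>
    have "norm (s (k + n) - s k) \<le> c * \<mu> ^ k * (1 - \<mu> ^ n) / (1 - \<mu>)"
    proof (induction n)
      case (Suc n)
      have "norm (s (k + Suc n) - s k) \<le> norm (s (Suc (k + n)) - s (k + n)) + norm (s (k + n) - s k)"
        using norm_triangle_ineq[of "s (Suc (k + n)) - s (k + n)" "s (k + n) - s k"] by simp
      also have "\<dots> \<le> c * \<mu> ^ (k + n) + c * \<mu> ^ k * (1 - \<mu> ^ n) / (1 - \<mu>)"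
        using Suc inc by (intro add_mono)
      also have "\<dots> = c * \<mu> ^ k * (1 - \<mu> ^ Suc n) / (1 - \<mu>)"
        using assms by (simp add: field_simps power_add)
      finally show ?case .
    qed simp
    also have "\<dots> \<le> c * \<mu> ^ k * 1 / (1 - \<mu>)"
      using assms c0 by (intro divide_right_mono mult_left_mono) auto
    finally show ?thesis by simp
  qed
  have "(\<lambda>n. norm (s (k + n) - s k)) \<longlonglongrightarrow> norm (lim s - s k)"
    using LIMSEQ_ignore_initial_segment[OF lim, of k]
    by (intro tendsto_intros) (simp add: add.commute)
  from tendsto_upperbound[OF this, of "c * \<mu> ^ k / (1 - \<mu>)"] bound
  show "norm (s k - lim s) \<le> c * \<mu> ^ k / (1 - \<mu>)"
    by (simp add: norm_minus_commute)
qed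

text \<open>Dyadic nesting: the cell containing a point at level \<open>k + 1\<close> is a child of
  the cell containing it at level \<open>k\<close>.\<close>

lemma floor_double_div2: "\<lfloor>2 * x\<rfloor> div 2 = \<lfloor>x :: real\<rfloor>"
  using floor_divide_real_eq_div[of 2 "2 * x"] by simp

text \<open>The limit function is the uniform limit of the step functions \<open>x \<mapsto> f\<^sup>k(\<lfloor>2\<^sup>k x\<rfloor>)\<close>; it is
  continuous because their jumps between neighbouring cells tend to zero.\<close>

lemma convergent_scheme_contractive:
  fixes T :: "(int \<Rightarrow> real^'n) \<Rightarrow> int \<Rightarrow> real^'n"
  assumes \<mu>: "0 \<le> \<mu>" "\<mu> < 1"
    and contract: "\<And>f d m. (\<And>i. norm (f (i + 1) - f i) \<le> d) \<Longrightarrow> norm (T f (m + 1) - T f m) \<le> \<mu> * d"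
    and near: "\<And>f d m. (\<And>i. norm (f (i + 1) - f i) \<le> d) \<Longrightarrow> norm (T f m - f (m div 2)) \<le> c * d"
    and const: "\<And>v. T (\<lambda>_. v) = (\<lambda>_. v)"
  shows "convergent_scheme (\<lambda>k. T)"
proof -
  define F where "F f0 k = iterates (\<lambda>k. T) f0 k" for f0 k
  define s where "s f0 x k = F f0 k \<lfloor>2 ^ k * x\<rfloor>" for f0 and x :: real and k
  define G where "G f0 x = lim (s f0 x)" for f0 x
  have main: "continuous_on UNIV (G f0) \<and> converges_uniformly_to (F f0) (G f0)"
    if f0: "f0 \<in> ell_infty" for f0
  proof -
    obtain b where b: "\<And>i. norm (f0 i) \<le> b"
      using f0 by (auto simp: ell_infty_def bounded_iff)
    define d where "d = 2 * b"
    have diff: "norm (F f0 k (i + 1) - F f0 k i) \<le> \<mu> ^ k * d" for k i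
    proof (induction k arbitrary: i)
      case 0
      show ?case
        using norm_triangle_ineq4[of "f0 (i + 1)" "f0 i"] b[of i] b[of "i + 1"]
        by (simp add: F_def d_def)
    next
      case (Suc k)
      from contract[of "F f0 k", OF Suc] show ?case by (simp add: F_def mult.assoc)
    qed
    \<comment> \<open>One refinement moves a child by at most \<open>c\<close> times the largest
      difference at level \<open>k\<close>, and that difference is at most
      \<open>\<mu> ^ k * d\<close>.\<close>
    have inc: "norm (s f0 x (Suc k) - s f0 x k) \<le> (c * d) * \<mu> ^ k" for x k
    proof -
      have "\<lfloor>2 ^ Suc k * x\<rfloor> div 2 = \<lfloor>2 ^ k * x\<rfloor>"
        using floor_double_div2[of "2 ^ k * x"] by (simp add: mult.assoc)
      then show ?thesis
        using near[of "F f0 k", OF diff, of "\<lfloor>2 ^ Suc k * x\<rfloor>"] by (simp add: s_def F_def mult_ac)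
    qed
    define e where "e k = c * d * \<mu> ^ k / (1 - \<mu>)" for k
    have e: "norm (s f0 x k - G f0 x) \<le> e k" for x k
      unfolding G_def e_def by (rule geometric_increments_limit(2)[OF \<mu> inc])
    have pow0: "(\<lambda>k. \<mu> ^ k) \<longlonglongrightarrow> 0"
      using \<mu> by (intro LIMSEQ_power_zero) auto
    have "(\<lambda>k. (c * d / (1 - \<mu>)) * \<mu> ^ k) \<longlonglongrightarrow> (c * d / (1 - \<mu>)) * 0"
      by (intro tendsto_intros pow0)
    then have e0: "e \<longlonglongrightarrow> 0"
      by (simp add: e_def[abs_def] mult_ac)
    have cell: "norm (F f0 k i - F f0 k j) \<le> \<mu> ^ k * d" if ij: "\<bar>i - j\<bar> \<le> 1" for k i j
    proof -
      consider "i = j" | "i = j + 1" | "j = i + 1"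
        using ij by linarith
      then show ?thesis
        using diff[of k i] diff[of k j] order_trans[OF norm_ge_zero diff[of k i]]
        by cases (auto simp: norm_minus_commute)
    qed
    have "continuous_on UNIV (G f0)"
      unfolding continuous_on_iff
    proof (intro ballI allI impI)
      fix x \<epsilon> :: real
      assume "0 < \<epsilon>"
      have "(\<lambda>k. 2 * e k + \<mu> ^ k * d) \<longlonglongrightarrow> 2 * 0 + 0 * d"
        by (intro tendsto_intros e0 pow0)
      then have "\<forall>\<^sub>F k in sequentially. 2 * e k + \<mu> ^ k * d < \<epsilon>"
        using \<open>0 < \<epsilon>\<close> by (intro order_tendstoD) auto
      then obtain k where k: "2 * e k + \<mu> ^ k * d < \<epsilon>"
        by (auto simp: eventually_sequentially)
      \<comment> \<open>Points this close lie in the same cell or in neighbouring cells of level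
        \<open>k\<close>. The step function changes by at most \<open>\<mu> ^ k * d\<close> between
        them, and replacing it by the limit costs \<open>e k\<close> at each point.\<close>
      have "dist (G f0 y) (G f0 x) < \<epsilon>" if "dist y x < 1 / 2 ^ k" for y
      proof -
        have "\<bar>2 ^ k * y - 2 ^ k * x\<bar> = 2 ^ k * \<bar>y - x\<bar>"
          by (simp add: abs_mult flip: right_diff_distrib)
        also have "\<dots> < 1"
          using that by (simp add: dist_real_def field_simps)
        finally have "\<bar>2 ^ k * y - 2 ^ k * x\<bar> < 1" .
        then have "\<bar>\<lfloor>2 ^ k * y\<rfloor> - \<lfloor>2 ^ k * x\<rfloor>\<bar> \<le> 1"
          by linarith
        then have "norm (s f0 y k - s f0 x k) \<le> \<mu> ^ k * d"
          unfolding s_def by (rule cell)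
        moreover have "dist (G f0 y) (G f0 x)
            \<le> norm (s f0 y k - G f0 y) + norm (s f0 y k - s f0 x k) + norm (s f0 x k - G f0 x)"
          by (smt (verit) dist_norm dist_commute dist_triangle)
        ultimately show ?thesis
          using e[of y k] e[of x k] k by linarith
      qed
      then show "\<exists>\<delta>>0. \<forall>y\<in>UNIV. dist y x < \<delta> \<longrightarrow> dist (G f0 y) (G f0 x) < \<epsilon>"
        by (intro exI[of _ "1 / 2 ^ k"]) auto
    qed
    moreover have "converges_uniformly_to (F f0) (G f0)"
      unfolding converges_uniformly_to_def
    proof (intro allI)
      fix a b :: real
      \<comment> \<open>At \<open>x = i / 2 ^ k\<close> the floor is exactly \<open>i\<close>, so
        one bound serves every grid point of the line and the interval does not enter.\<close>
      have "norm (F f0 k i - G f0 (real_of_int i / 2 ^ k)) \<le> e k" for k i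
        using e[of "real_of_int i / 2 ^ k" k] by (simp add: s_def)
      then have "(SUP i \<in> {i. real_of_int i \<in> (\<lambda>x. 2 ^ k * x) ` {a..b}}.
          ennreal (norm (F f0 k i - G f0 (real_of_int i / 2 ^ k)))) \<le> ennreal (e k)" for k
        by (intro SUP_least ennreal_leI)
      moreover have "(\<lambda>k. ennreal (e k)) \<longlonglongrightarrow> 0"
        using tendsto_ennrealI[OF e0] by simp
      ultimately show "(\<lambda>k. SUP i \<in> {i. real_of_int i \<in> (\<lambda>x. 2 ^ k * x) ` {a..b}}.
          ennreal (norm (F f0 k i - G f0 (real_of_int i / 2 ^ k)))) \<longlonglongrightarrow> 0"
        by - (rule tendsto_sandwich[where f = "\<lambda>_. 0" and h = "\<lambda>k. ennreal (e k)"],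
          auto intro: always_eventually)
    qed
    ultimately show ?thesis ..
  qed
  obtain v :: "real^'n" where v: "v \<noteq> 0"
    using SOME_Basis nonzero_Basis by blast
  \<comment> \<open>Reproduction of a nonzero constant shows that the limit operator is not
    zero.\<close>
  have "F (\<lambda>_. v) k = (\<lambda>_. v)" for k
    by (induction k) (simp_all add: F_def const)
  then have "G (\<lambda>_. v) x = v" for x
    by (simp add: G_def s_def[abs_def] limI)
  then have "G (\<lambda>_. v) \<noteq> (\<lambda>x. 0)"
    using v by (metis (no_types))
  moreover have "(\<lambda>_. v) \<in> ell_infty"
    by (simp add: ell_infty_def)
  ultimately show ?thesis
    using main unfolding convergent_scheme_def F_def by blast
qed

section \<open>The dual four-point scheme\<close>

lemma window_1: "window (Suc 0) = {- 1, 0, 1, 2}"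
  by (auto simp: window_def)

text \<open>These are the cubic Lagrange weights for the nodes -1, 0, 1, 2, evaluated at 1/4 for
  \<open>l = 0\<close> and at 3/4 for \<open>l = 1\<close>. The restriction to the window makes them
  equal, as functions, to the weights of the geometric scheme at zero.\<close>

definition dual_4pt :: "nat \<Rightarrow> int \<Rightarrow> real" where
  "dual_4pt l = (\<lambda>j\<in>window 1. if l = 0 then lagrange_coeff 1 1 j else lagrange_coeff 1 1 (1 - j))"

abbreviation dual_4pt_op :: "(int \<Rightarrow> real^'n) \<Rightarrow> int \<Rightarrow> real^'n" where
  "dual_4pt_op \<equiv> uniform_op 1 (\<lambda>l. pairing 1 (dual_4pt l))"

lemma dual_4pt_op_even:
  "dual_4pt_op f (2 * i) = (- 7/128) *\<^sub>R f (i - 1) + (105/128) *\<^sub>R f i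
     + (35/128) *\<^sub>R f (i + 1) + (- 5/128) *\<^sub>R f (i + 2)"
  by (simp add: uniform_op_def pairing_def window_1 dual_4pt_def lagrange_coeff_def)

lemma dual_4pt_op_odd:
  "dual_4pt_op f (2 * i + 1) = (- 5/128) *\<^sub>R f (i - 1) + (35/128) *\<^sub>R f i
     + (105/128) *\<^sub>R f (i + 1) + (- 7/128) *\<^sub>R f (i + 2)"
  by (simp add: uniform_op_def pairing_def window_1 dual_4pt_def lagrange_coeff_def)

text \<open>Reduces each estimate for a mask to the sum of the absolute values of its
  weights.\<close>

lemma norm_combination4_le:
  fixes x y z w :: "'a::real_normed_vector"
  assumes "norm x \<le> d" "norm y \<le> d" "norm z \<le> d" "norm w \<le> d"
  shows "norm (a *\<^sub>R x + b *\<^sub>R y + c *\<^sub>R z + e *\<^sub>R w) \<le> (\<bar>a\<bar> + \<bar>b\<bar> + \<bar>c\<bar> + \<bar>e\<bar>) * d"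
proof -
  have "norm (a *\<^sub>R x + b *\<^sub>R y + c *\<^sub>R z + e *\<^sub>R w)
      \<le> \<bar>a\<bar> * norm x + \<bar>b\<bar> * norm y + \<bar>c\<bar> * norm z + \<bar>e\<bar> * norm w"
    by (intro order_trans[OF norm_triangle_ineq] add_mono) simp_all
  also have "\<dots> \<le> \<bar>a\<bar> * d + \<bar>b\<bar> * d + \<bar>c\<bar> * d + \<bar>e\<bar> * d"
    using assms by (intro add_mono mult_left_mono) auto
  finally show ?thesis by (simp add: distrib_right)
qed

text \<open>The two difference masks have absolute sums 72/128 and 84/128, and the larger one is the
  contraction factor. The distance from a child to its parent \<open>f (m div 2)\<close> has the
  sums 42/128 and 110/128, so \<open>c = 1\<close> suffices.\<close>

lemma convergent_dual_4pt:
  "convergent_scheme (\<lambda>k. dual_4pt_op :: (int \<Rightarrow> real^'n) \<Rightarrow> int \<Rightarrow> real^'n)"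
proof (rule convergent_scheme_contractive[where \<mu> = "84/128" and c = 1])
  fix f :: "int \<Rightarrow> real^'n" and d and m :: int
  assume d: "norm (f (i + 1) - f i) \<le> d" for i
  then have d0: "0 \<le> d"
    using norm_ge_zero order_trans by blast
  define i where "i = m div 2"
  define g where "g j = f (i + j + 1) - f (i + j)" for j :: int
  have g: "norm (g j) \<le> d" for j
    using d by (simp add: g_def)
  have le: "norm (a *\<^sub>R g (- 1) + b *\<^sub>R g 0 + c *\<^sub>R g 1 + e *\<^sub>R g 2) \<le> K * d"
    if "\<bar>a\<bar> + \<bar>b\<bar> + \<bar>c\<bar> + \<bar>e\<bar> \<le> K" for a b c e K
    using norm_combination4_le[OF g g g g] mult_right_mono[OF that d0] by (rule order_trans)
  have f: "f i = f (i - 1) + g (- 1)" "f (i + 1) = f (i - 1) + g (- 1) + g 0"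
      "f (i + 2) = f (i - 1) + g (- 1) + g 0 + g 1" "f (i + 3) = f (i - 1) + g (- 1) + g 0 + g 1 + g 2"
    by (simp_all add: g_def add_ac)
  \<comment> \<open>Both orders of the summands in the arguments are supplied, so that the rewriting
    matches whichever one the simplifier produces.\<close>
  note f = f f[unfolded add.commute[of i]]
  have m: "m = 2 * i \<or> m = 2 * i + 1"
    unfolding i_def by linarith
  then show "norm (dual_4pt_op f (m + 1) - dual_4pt_op f m) \<le> 84/128 * d"
  proof
    assume m: "m = 2 * i"
    \<comment> \<open>Both children belong to the same cell, so three differences suffice; the zero
      term pads the sum to the four-term shape of \<open>le\<close>.\<close>
    have "dual_4pt_op f (m + 1) - dual_4pt_op f m
        = (- 2/128) *\<^sub>R g (- 1) + (68/128) *\<^sub>R g 0 + (- 2/128) *\<^sub>R g 1 + 0 *\<^sub>R g 2"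
      unfolding m dual_4pt_op_even dual_4pt_op_odd by (simp add: f vec_eq_iff field_simps)
    then show ?thesis by (simp only:) (rule le, simp)
  next
    assume m: "m = 2 * i + 1"
    \<comment> \<open>Here \<open>m + 1\<close> is the even child of the next cell. Five consecutive
      data points take part, hence all four differences.\<close>
    then have m1: "m + 1 = 2 * (i + 1)" by simp
    have "dual_4pt_op f (m + 1) - dual_4pt_op f m
        = (- 5/128) *\<^sub>R g (- 1) + (37/128) *\<^sub>R g 0 + (37/128) *\<^sub>R g 1 + (- 5/128) *\<^sub>R g 2"
      unfolding m1 unfolding m dual_4pt_op_even dual_4pt_op_odd
      by (simp add: f vec_eq_iff field_simps)
    then show ?thesis by (simp only:) (rule le, simp)
  qed
  from m have "norm (dual_4pt_op f m - f i) \<le> 1 * d"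
  proof
    assume m: "m = 2 * i"
    have "dual_4pt_op f m - f i
        = (7/128) *\<^sub>R g (- 1) + (30/128) *\<^sub>R g 0 + (- 5/128) *\<^sub>R g 1 + 0 *\<^sub>R g 2"
      unfolding m dual_4pt_op_even by (simp add: f vec_eq_iff field_simps)
    then show ?thesis by (simp only:) (rule le, simp)
  next
    assume m: "m = 2 * i + 1"
    have "dual_4pt_op f m - f i
        = (5/128) *\<^sub>R g (- 1) + (98/128) *\<^sub>R g 0 + (- 7/128) *\<^sub>R g 1 + 0 *\<^sub>R g 2"
      unfolding m dual_4pt_op_odd by (simp add: f vec_eq_iff field_simps)
    then show ?thesis by (simp only:) (rule le, simp)
  qed
  then show "norm (dual_4pt_op f m - f (m div 2)) \<le> 1 * d"
    by (simp only: i_def)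
next
  fix v :: "real^'n"
  have "dual_4pt_op (\<lambda>_. v) m = v" for m
  proof -
    have "m = 2 * (m div 2) \<or> m = 2 * (m div 2) + 1" by linarith
    then show ?thesis
    proof
      assume "m = 2 * (m div 2)"
      from dual_4pt_op_even[of "\<lambda>_. v" "m div 2", folded this] show ?thesis
        by (simp only:) (simp add: vec_eq_iff field_simps)
    next
      assume "m = 2 * (m div 2) + 1"
      from dual_4pt_op_odd[of "\<lambda>_. v" "m div 2", folded this] show ?thesis
        by (simp only:) (simp add: vec_eq_iff field_simps)
    qed
  qed
  then show "dual_4pt_op (\<lambda>_. v) = (\<lambda>_. v)" ..
qed auto

section \<open>Lipschitz estimates at a point\<close>

text \<open>Class B compares weights only with those at the origin, so one point is held fixed. In
  the application \<open>a\<close> is the origin and \<open>N\<close> a norm, so that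
  \<open>N x\<close> is the distance from \<open>a\<close>.\<close>

definition lipschitz_at :: "'a set \<Rightarrow> ('a \<Rightarrow> real) \<Rightarrow> 'a \<Rightarrow> ('a \<Rightarrow> real) \<Rightarrow> bool" where
  "lipschitz_at D N a f \<longleftrightarrow> (\<exists>C\<ge>0. \<forall>x\<in>D. \<bar>f x - f a\<bar> \<le> C * N x)"

lemma lipschitz_at_const: "lipschitz_at D N a (\<lambda>x. c)"
  unfolding lipschitz_at_def by (intro exI[of _ 0]) auto

lemma lipschitz_at_add:
  assumes "lipschitz_at D N a f" "lipschitz_at D N a g"
  shows "lipschitz_at D N a (\<lambda>x. f x + g x)"
proof -
  obtain C K where C: "C \<ge> 0" "\<And>x. x \<in> D \<Longrightarrow> \<bar>f x - f a\<bar> \<le> C * N x"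
      and K: "K \<ge> 0" "\<And>x. x \<in> D \<Longrightarrow> \<bar>g x - g a\<bar> \<le> K * N x"
    using assms unfolding lipschitz_at_def by blast
  have "\<bar>f x + g x - (f a + g a)\<bar> \<le> (C + K) * N x" if "x \<in> D" for x
    using C(2)[OF that] K(2)[OF that] by (simp add: distrib_right)
  with C K show ?thesis
    unfolding lipschitz_at_def by (intro exI[of _ "C + K"]) auto
qed

lemma lipschitz_at_minus:
  "lipschitz_at D N a f \<Longrightarrow> lipschitz_at D N a (\<lambda>x. - f x)"
  unfolding lipschitz_at_def by (simp add: abs_minus_commute)

text \<open>The usual product rule; the bound \<open>R\<close> on \<open>N\<close> keeps the second
  factor bounded on \<open>D\<close>.\<close>

lemma lipschitz_at_mult:
  assumes N: "\<And>x. x \<in> D \<Longrightarrow> 0 \<le> N x \<and> N x \<le> R"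
    and "lipschitz_at D N a f" "lipschitz_at D N a g"
  shows "lipschitz_at D N a (\<lambda>x. f x * g x)"
proof -
  obtain C K where C: "C \<ge> 0" "\<And>x. x \<in> D \<Longrightarrow> \<bar>f x - f a\<bar> \<le> C * N x"
      and K: "K \<ge> 0" "\<And>x. x \<in> D \<Longrightarrow> \<bar>g x - g a\<bar> \<le> K * N x"
    using assms unfolding lipschitz_at_def by blast
  define L where "L = C * (\<bar>g a\<bar> + K * \<bar>R\<bar>) + \<bar>f a\<bar> * K"
  have "\<bar>f x * g x - f a * g a\<bar> \<le> L * N x" if x: "x \<in> D" for x
  proof -
    have "K * N x \<le> K * \<bar>R\<bar>"
      using N[OF x] K(1) by (intro mult_left_mono) auto
    then have gx: "\<bar>g x\<bar> \<le> \<bar>g a\<bar> + K * \<bar>R\<bar>"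
      using K(2)[OF x] by linarith
    have "f x * g x - f a * g a = (f x - f a) * g x + f a * (g x - g a)"
      by (simp add: algebra_simps)
    then have "\<bar>f x * g x - f a * g a\<bar> \<le> \<bar>f x - f a\<bar> * \<bar>g x\<bar> + \<bar>f a\<bar> * \<bar>g x - g a\<bar>"
      by (metis abs_mult abs_triangle_ineq)
    also have "\<dots> \<le> (C * N x) * (\<bar>g a\<bar> + K * \<bar>R\<bar>) + \<bar>f a\<bar> * (K * N x)"
      using C(1) C(2)[OF x] K(2)[OF x] gx N[OF x] by (intro add_mono mult_mono) auto
    also have "\<dots> = L * N x"
      by (simp add: L_def algebra_simps)
    finally show ?thesis .
  qed
  moreover have "L \<ge> 0"
    using C K by (simp add: L_def)
  ultimately show ?thesis
    unfolding lipschitz_at_def by blast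
qed

text \<open>The difference of the inverses is \<open>(g a - g x) / (g x * g a)\<close>, whose
  denominator is at least \<open>c * c\<close>.\<close>

lemma lipschitz_at_inverse:
  assumes "a \<in> D" "c > 0" and c: "\<And>x. x \<in> D \<Longrightarrow> c \<le> g x"
    and "lipschitz_at D N a g"
  shows "lipschitz_at D N a (\<lambda>x. inverse (g x))"
proof -
  obtain K where K: "K \<ge> 0" "\<And>x. x \<in> D \<Longrightarrow> \<bar>g x - g a\<bar> \<le> K * N x"
    using assms unfolding lipschitz_at_def by blast
  have "\<bar>inverse (g x) - inverse (g a)\<bar> \<le> (K / (c * c)) * N x" if x: "x \<in> D" for x
  proof -
    have pos: "0 < g x" "0 < g a" "c \<le> g x" "c \<le> g a"
      using c[OF x] c[OF \<open>a \<in> D\<close>] \<open>c > 0\<close> by auto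
    then have "inverse (g x) - inverse (g a) = (g a - g x) / (g x * g a)"
      by (simp add: field_simps)
    with pos have "\<bar>inverse (g x) - inverse (g a)\<bar> = \<bar>g x - g a\<bar> / (g x * g a)"
      by (simp add: abs_divide abs_mult abs_minus_commute)
    also have "\<dots> \<le> (K * N x) / (c * c)"
      using pos K(2)[OF x] \<open>c > 0\<close> by (intro frac_le mult_mono) auto
    finally show ?thesis by simp
  qed
  then show ?thesis
    unfolding lipschitz_at_def using K(1) \<open>c > 0\<close> by (intro exI[of _ "K / (c * c)"]) auto
qed

lemma lipschitz_at_divide:
  assumes "\<And>x. x \<in> D \<Longrightarrow> 0 \<le> N x \<and> N x \<le> R" "a \<in> D" "c > 0" "\<And>x. x \<in> D \<Longrightarrow> c \<le> g x"
    and "lipschitz_at D N a f" "lipschitz_at D N a g"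
  shows "lipschitz_at D N a (\<lambda>x. f x / g x)"
  unfolding divide_inverse
  by (intro lipschitz_at_mult lipschitz_at_inverse) (fact assms)+

text \<open>Each coefficient is a quotient of polynomials in \<alpha> and \<beta>, so the closure
  rules apply once the denominators are bounded away from zero.\<close>

lemma lipschitz_at_lagrange_coeff:
  assumes N: "\<And>x. x \<in> D \<Longrightarrow> 0 \<le> N x \<and> N x \<le> R" and a: "a \<in> D" and c: "c > 0"
    and low: "\<And>x. x \<in> D \<Longrightarrow> c \<le> \<alpha> x" "\<And>x. x \<in> D \<Longrightarrow> c \<le> \<beta> x"
    and lip: "lipschitz_at D N a \<alpha>" "lipschitz_at D N a \<beta>"
  shows "lipschitz_at D N a (\<lambda>x. lagrange_coeff (\<alpha> x) (\<beta> x) j)"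
proof -
  have mult: "lipschitz_at D N a (\<lambda>x. f x * g x)"
    if "lipschitz_at D N a f" "lipschitz_at D N a g" for f g
    by (rule lipschitz_at_mult) (fact N that)+
  note rules = lipschitz_at_add mult lipschitz_at_minus lipschitz_at_const lip
  \<comment> \<open>The bound \<open>c\<close> itself works: one factor is at least
    \<open>c\<close>, the other at least 1.\<close>
  have den1: "c \<le> 64 * (s\<^sup>2 + s) * (s + t + 1)" and den2: "c \<le> 64 * s * (t + 1)"
    if "c \<le> s" "c \<le> t" for s t :: real
  proof -
    have "c * 1 \<le> (64 * (s\<^sup>2 + s)) * (s + t + 1)"
      using that c by (intro mult_mono) (auto intro: order_trans[of c s] add_nonneg_nonneg)
    then show "c \<le> 64 * (s\<^sup>2 + s) * (s + t + 1)" by simp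
    have "c * 1 \<le> (64 * s) * (t + 1)"
      using that c by (intro mult_mono) auto
    then show "c \<le> 64 * s * (t + 1)" by simp
  qed
  have quot: "lipschitz_at D N a (\<lambda>x. f x / g x)"
    if "\<And>x. x \<in> D \<Longrightarrow> c \<le> g x" "lipschitz_at D N a f" "lipschitz_at D N a g" for f g
    by (rule lipschitz_at_divide) (fact N a c that)+
  have "lipschitz_at D N a
      (\<lambda>x. - (3 * (4 * \<beta> x + 3)) / (64 * ((\<alpha> x)\<^sup>2 + \<alpha> x) * (\<alpha> x + \<beta> x + 1)))"
    unfolding power2_eq_square
    by (rule quot) (intro den1[unfolded power2_eq_square] low rules; assumption)+
  moreover have "lipschitz_at D N a
      (\<lambda>x. (3 * (4 * \<alpha> x + 1) * (4 * \<beta> x + 3)) / (64 * \<alpha> x * (\<beta> x + 1)))"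
    by (rule quot) (intro den2 low rules; assumption)+
  moreover have "lipschitz_at D N a
      (\<lambda>x. ((4 * \<alpha> x + 1) * (4 * \<beta> x + 3)) / (64 * \<beta> x * (\<alpha> x + 1)))"
    by (rule quot) (intro den2 low rules; assumption)+
  moreover have "lipschitz_at D N a
      (\<lambda>x. - (3 * (4 * \<alpha> x + 1)) / (64 * ((\<beta> x)\<^sup>2 + \<beta> x) * (\<alpha> x + \<beta> x + 1)))"
    \<comment> \<open>Here \<beta> takes the role of \<open>s\<close> in \<open>den1\<close>, so the
      sum in the last factor has to be swapped.\<close>
    unfolding power2_eq_square add.commute[of "\<alpha> _" "\<beta> _"]
    by (rule quot) (intro den1[unfolded power2_eq_square] low rules; assumption)+
  ultimately show ?thesis
    by (cases "j = -1"; cases "j = 0"; cases "j = 1"; cases "j = 2")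
      (simp_all add: lagrange_coeff_def lipschitz_at_const)
qed

lemma lipschitz_at_sum_bound:
  assumes N: "\<And>x. x \<in> D \<Longrightarrow> 0 \<le> N x" and "finite J"
    and "\<And>j. j \<in> J \<Longrightarrow> lipschitz_at D N a (\<lambda>x. f x j)"
  shows "\<exists>C\<ge>0. \<forall>x\<in>D. (\<Sum>j\<in>J. \<bar>f x j - f a j\<bar>) \<le> C * N x"
proof -
  have "\<forall>j\<in>J. \<exists>C\<ge>0. \<forall>x\<in>D. \<bar>f x j - f a j\<bar> \<le> C * N x"
    using assms by (auto simp: lipschitz_at_def)
  then obtain C where C: "\<forall>j\<in>J. 0 \<le> C j \<and> (\<forall>x\<in>D. \<bar>f x j - f a j\<bar> \<le> C j * N x)"
    by metis
  then have "\<forall>x\<in>D. (\<Sum>j\<in>J. \<bar>f x j - f a j\<bar>) \<le> (\<Sum>j\<in>J. C j) * N x"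
    by (auto simp: sum_distrib_right intro!: sum_mono)
  with C show ?thesis
    by (intro exI[of _ "\<Sum>j\<in>J. C j"]) (auto intro: sum_nonneg)
qed

section \<open>The geometric scheme\<close>

text \<open>Definiteness rests on extensionality: a vanishing sum determines \<open>x\<close> only
  on \<open>I\<close>.\<close>

lemma norm_on_l1:
  assumes "finite I"
  shows "norm_on I (\<lambda>x. \<Sum>i\<in>I. \<bar>x i\<bar>)"
proof -
  have "(\<Sum>i\<in>I. \<bar>x i\<bar>) = 0 \<longleftrightarrow> x = (\<lambda>i\<in>I. 0)" if "x \<in> I \<rightarrow>\<^sub>E UNIV" for x :: "'a \<Rightarrow> real"
    using assms that by (auto simp: sum_nonneg_eq_0_iff PiE_def extensional_def fun_eq_iff)
  moreover have "(\<Sum>i\<in>I. \<bar>x i + y i\<bar>) \<le> (\<Sum>i\<in>I. \<bar>x i\<bar>) + (\<Sum>i\<in>I. \<bar>y i\<bar>)" for x y :: "'a \<Rightarrow> real"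
    unfolding sum.distrib[symmetric] by (intro sum_mono) auto
  ultimately show ?thesis
    unfolding norm_on_def by (simp add: sum_nonneg abs_mult sum_distrib_left)
qed

text \<open>The clamping to \<open>[1/(1+t), 1+t]\<close> with \<open>t = (1/2) ^ k * \<rho>\<close>
  gives all three bounds. The distance to 1 uses \<open>1 - t \<le> 1/(1+t)\<close>, and
  \<open>t \<le> \<rho>\<close> removes the dependence on \<open>k\<close>.\<close>

lemma alpha_bounds:
  assumes "\<rho> \<ge> 0"
  shows "inverse (1 + \<rho>) \<le> alpha \<rho> k A B" "alpha \<rho> k A B \<le> 1 + \<rho>"
    "\<bar>alpha \<rho> k A B - 1\<bar> \<le> (1/2) ^ k * \<rho>"
proof -
  define t where "t = (1/2) ^ k * \<rho>"
  have t: "0 \<le> t" "t \<le> \<rho>"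
    using assms by (auto simp: t_def intro!: mult_left_le_one_le power_le_one)
  have inv: "inverse (1 + t) \<le> 1" "1 - t \<le> inverse (1 + t)" "inverse (1 + \<rho>) \<le> inverse (1 + t)"
    using t by (auto simp: field_simps)
  have "inverse (1 + t) \<le> alpha \<rho> k A B" "alpha \<rho> k A B \<le> 1 + t"
    using inv t unfolding alpha_def t_def[symmetric] by auto
  then show "inverse (1 + \<rho>) \<le> alpha \<rho> k A B" "alpha \<rho> k A B \<le> 1 + \<rho>"
      "\<bar>alpha \<rho> k A B - 1\<bar> \<le> (1/2) ^ k * \<rho>"
    using t inv unfolding t_def[symmetric] by linarith+
qed

section \<open>Bounded data stay bounded\<close>

lemma norm_pairing_le:
  assumes "\<And>j. j \<in> window p \<Longrightarrow> norm (f j) \<le> b"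
  shows "norm (pairing p a f) \<le> (\<Sum>j\<in>window p. \<bar>a j\<bar>) * b"
proof -
  have "norm (pairing p a f) \<le> (\<Sum>j\<in>window p. norm (a j *\<^sub>R f j))"
    unfolding pairing_def by (rule norm_sum)
  also have "\<dots> \<le> (\<Sum>j\<in>window p. \<bar>a j\<bar> * b)"
    using assms by (intro sum_mono) (simp add: mult_left_mono)
  finally show ?thesis by (simp add: sum_distrib_right)
qed

text \<open>The weights may depend on the data; a uniform bound on their absolute sums is enough for
  the operator to map bounded sequences to bounded ones.\<close>

lemma uniform_op_pairing_ell_infty:
  assumes "f \<in> ell_infty"
    and rule: "\<And>l f. l \<in> {0, 1} \<Longrightarrow> f \<in> window p \<rightarrow>\<^sub>E UNIV \<Longrightarrow> \<psi> l f = pairing p (w l f) f"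
    and bound: "\<And>l f. l \<in> {0, 1} \<Longrightarrow> f \<in> window p \<rightarrow>\<^sub>E UNIV \<Longrightarrow> (\<Sum>j\<in>window p. \<bar>w l f j\<bar>) \<le> K"
  shows "uniform_op p \<psi> f \<in> ell_infty"
proof -
  obtain b where b: "\<And>i. norm (f i) \<le> b"
    using assms(1) by (auto simp: ell_infty_def bounded_iff)
  then have b0: "0 \<le> b"
    using norm_ge_zero order_trans by blast
  have "norm (uniform_op p \<psi> f m) \<le> K * b" for m
  proof -
    define l where "l = nat (m mod 2)"
    define F where "F = (\<lambda>j\<in>window p. f (m div 2 + j))"
    have F: "F \<in> window p \<rightarrow>\<^sub>E UNIV" and l: "l \<in> {0, 1}"
      by (auto simp: F_def l_def)
    have "norm (pairing p (w l F) F) \<le> (\<Sum>j\<in>window p. \<bar>w l F j\<bar>) * b"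
      using b by (intro norm_pairing_le) (simp add: F_def)
    also have "\<dots> \<le> K * b"
      by (rule mult_right_mono[OF bound[OF l F] b0])
    finally have "norm (\<psi> l F) \<le> K * b"
      by (simp only: rule[OF l F])
    then show ?thesis
      by (simp add: uniform_op_def l_def F_def)
  qed
  then show ?thesis
    by (auto simp: ell_infty_def bounded_iff)
qed

text \<open>A point \<open>x\<close> of \<open>\<real>\<^sup>2\<close> encodes the tension parameters \<open>\<alpha> = 1 + x\<^sub>1\<close> and \<open>\<beta> = 1 + x\<^sub>2\<close>.\<close>

definition tension_domain :: "real \<Rightarrow> (nat \<Rightarrow> real) set" where
  "tension_domain \<rho> = {x \<in> {1..2} \<rightarrow>\<^sub>E UNIV. \<forall>i\<in>{1..2}. inverse (1 + \<rho>) \<le> 1 + x i \<and> 1 + x i \<le> 1 + \<rho>}"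

definition tension :: "real \<Rightarrow> nat \<Rightarrow> (int \<Rightarrow> real^'n) \<Rightarrow> nat \<Rightarrow> real" where
  "tension \<rho> k f =
     (let A = coeff_A (nabla f (-1)) (nabla f 0) (nabla f 1);
          B = coeff_B (nabla f (-1)) (nabla f 0) (nabla f 1)
      in (\<lambda>i\<in>{1..2}. (if i = 1 then alpha \<rho> k A B else beta \<rho> k A B) - 1))"

definition lagrange_weights :: "nat \<Rightarrow> (nat \<Rightarrow> real) \<Rightarrow> int \<Rightarrow> real" where
  "lagrange_weights l x = (\<lambda>j\<in>window 1.
     if l = 0 then lagrange_coeff (1 + x 1) (1 + x 2) j
     else lagrange_coeff (1 + x 2) (1 + x 1) (1 - j))"

text \<open>The form required by class B: the nonlinearity enters only through the weights.\<close>

lemma geom_rule_eq_pairing: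
  "geom_rule \<rho> k l f = pairing 1 (lagrange_weights l (tension \<rho> k f)) f"
  by (auto simp: geom_rule_def Let_def lagrange_rule_def pairing_def lagrange_weights_def
      tension_def window_def intro!: sum.cong)

lemma tension_in_domain: "\<rho> \<ge> 0 \<Longrightarrow> tension \<rho> k f \<in> tension_domain \<rho>"
proof -
  assume \<rho>: "\<rho> \<ge> 0"
  have "inverse (1 + \<rho>) \<le> 1 + tension \<rho> k f i \<and> 1 + tension \<rho> k f i \<le> 1 + \<rho>"
    if i: "i \<in> {1..2}" for i
  proof -
    obtain A B where "1 + tension \<rho> k f i = alpha \<rho> k A B"
      using i by (cases "i = 1") (auto simp: tension_def Let_def beta_def)
    then show ?thesis
      using alpha_bounds[OF \<rho>] by simp
  qed
  moreover have "tension \<rho> k f \<in> {1..2} \<rightarrow>\<^sub>E UNIV"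
    by (simp add: tension_def Let_def)
  ultimately show ?thesis
    by (simp add: tension_domain_def)
qed

lemma sum_1_2: "(\<Sum>i\<in>{1..2::nat}. g i) = g 1 + g 2"
  by (simp add: numeral_2_eq_2)

lemma tension_l1_le:
  assumes "\<rho> \<ge> 0"
  shows "(\<Sum>i\<in>{1..2}. \<bar>tension \<rho> k f i\<bar>) \<le> (1/2) ^ k * (2 * \<rho>)"
proof -
  have "\<bar>tension \<rho> k f i\<bar> \<le> (1/2) ^ k * \<rho>" if "i \<in> {1..2}" for i
    using that alpha_bounds(3)[OF assms] by (auto simp: tension_def Let_def beta_def)
  from this[of 1] this[of 2] show ?thesis
    unfolding sum_1_2 by simp
qed

text \<open>On the domain both parameters are at least \<open>inverse (1 + \<rho>)\<close>, and as
  functions of \<open>x\<close> they are Lipschitz with constant 1. The mirrored rule is the same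
  estimate with the parameters exchanged.\<close>

lemma lagrange_weights_lipschitz:
  assumes "\<rho> \<ge> 0"
  shows "\<exists>C\<ge>0. \<forall>x\<in>tension_domain \<rho>.
    (\<Sum>j\<in>window 1. \<bar>lagrange_weights l x j - lagrange_weights l (\<lambda>i\<in>{1..2}. 0) j\<bar>)
      \<le> C * (\<Sum>i\<in>{1..2}. \<bar>x i\<bar>)"
proof (rule lipschitz_at_sum_bound)
  let ?D = "tension_domain \<rho>" and ?N = "\<lambda>x. \<Sum>i\<in>{1..2::nat}. \<bar>x i :: real\<bar>"
    and ?a = "\<lambda>i\<in>{1..2::nat}. 0 :: real"
  have r: "0 < inverse (1 + \<rho>)" "inverse (1 + \<rho>) \<le> 1"
    using assms by (auto simp: field_simps)
  have a: "?a \<in> ?D"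
    using assms r by (auto simp: tension_domain_def)
  have low: "inverse (1 + \<rho>) \<le> 1 + x 1" "inverse (1 + \<rho>) \<le> 1 + x 2"
    and N: "0 \<le> ?N x \<and> ?N x \<le> 2 * (1 + \<rho>)" if "x \<in> ?D" for x
  proof -
    have x: "inverse (1 + \<rho>) \<le> 1 + x i \<and> 1 + x i \<le> 1 + \<rho>" if "i \<in> {1..2}" for i
      using \<open>x \<in> ?D\<close> that by (auto simp: tension_domain_def)
    then show "inverse (1 + \<rho>) \<le> 1 + x 1" "inverse (1 + \<rho>) \<le> 1 + x 2"
      by auto
    have "\<bar>x i\<bar> \<le> 1 + \<rho>" if "i \<in> {1..2}" for i
      using x[OF that] r assms by linarith
    from this[of 1] this[of 2] show "0 \<le> ?N x \<and> ?N x \<le> 2 * (1 + \<rho>)"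
      unfolding sum_1_2 by simp
  qed
  have coord: "lipschitz_at ?D ?N ?a (\<lambda>x. 1 + x 1)" "lipschitz_at ?D ?N ?a (\<lambda>x. 1 + x 2)"
    unfolding lipschitz_at_def sum_1_2 by (intro exI[of _ 1]; simp)+
  fix j assume j: "j \<in> window 1"
  have coeff: "lipschitz_at ?D ?N ?a (\<lambda>x. lagrange_coeff (\<alpha> x) (\<beta> x) j)"
    if "\<And>x. x \<in> ?D \<Longrightarrow> inverse (1 + \<rho>) \<le> \<alpha> x" "\<And>x. x \<in> ?D \<Longrightarrow> inverse (1 + \<rho>) \<le> \<beta> x"
      "lipschitz_at ?D ?N ?a \<alpha>" "lipschitz_at ?D ?N ?a \<beta>" for \<alpha> \<beta> j
    by (rule lipschitz_at_lagrange_coeff) (fact N a r(1) that)+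
  have "lipschitz_at ?D ?N ?a (\<lambda>x. lagrange_coeff (1 + x 1) (1 + x 2) j)"
    by (rule coeff) (fact low coord)+
  moreover have "lipschitz_at ?D ?N ?a (\<lambda>x. lagrange_coeff (1 + x 2) (1 + x 1) (1 - j))"
    by (rule coeff) (fact low coord)+
  ultimately show "lipschitz_at ?D ?N ?a (\<lambda>x. lagrange_weights l x j)"
    unfolding lagrange_weights_def restrict_apply'[OF j] by (cases "l = 0") (simp_all del: One_nat_def)
qed (auto simp: window_def sum_nonneg)

theorem proposition32:
  fixes \<rho> :: real
  assumes "CARD('n::finite) \<ge> 2"
    and "\<rho> \<ge> 0"
  shows "class_B (geom_scheme \<rho> :: nat \<Rightarrow> (int \<Rightarrow> real^'n) \<Rightarrow> int \<Rightarrow> real^'n)"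
proof -
  let ?D = "tension_domain \<rho>" and ?N = "\<lambda>x. \<Sum>i\<in>{1..2::nat}. \<bar>x i :: real\<bar>"
    and ?a = "\<lambda>i\<in>{1..2::nat}. 0 :: real" and ?M = "\<lambda>x. \<Sum>j\<in>window 1. \<bar>x j :: real\<bar>"
  let ?\<pi> = "tension \<rho> :: nat \<Rightarrow> (int \<Rightarrow> real^'n) \<Rightarrow> nat \<Rightarrow> real"
  obtain C where C: "\<And>l. C l \<ge> 0" "\<And>l x. x \<in> ?D \<Longrightarrow>
      (\<Sum>j\<in>window 1. \<bar>lagrange_weights l x j - lagrange_weights l ?a j\<bar>) \<le> C l * ?N x"
    using lagrange_weights_lipschitz[OF assms(2)] by metis
  \<comment> \<open>One constant for both rules; the summand 1 makes it strictly positive.\<close>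
  define K where "K = C 0 + C 1 + 1"
  have K: "(\<Sum>j\<in>window 1. \<bar>lagrange_weights l x j - lagrange_weights l ?a j\<bar>) \<le> K * ?N x"
    if "l \<in> {0, 1}" "x \<in> ?D" for l x
  proof -
    have "C l \<le> K"
      using that C(1)[of 0] C(1)[of 1] by (auto simp: K_def)
    then have "C l * ?N x \<le> K * ?N x"
      by (intro mult_right_mono sum_nonneg) auto
    with C(2)[OF that(2), of l] show ?thesis by linarith
  qed
  have K0: "K > 0"
    using C(1)[of 0] C(1)[of 1] by (simp add: K_def)
  \<comment> \<open>\<open>W\<close> bounds the weights of the linear scheme; the Lipschitz estimate
    adds at most \<open>K * (2 * \<rho>)\<close> at every level.\<close>
  define W where "W = ?M (lagrange_weights 0 ?a) + ?M (lagrange_weights 1 ?a)"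
  have weights: "?M (lagrange_weights l (?\<pi> k f)) \<le> W + K * (2 * \<rho>)" if l: "l \<in> {0, 1}" for l k f
  proof -
    have "?M (lagrange_weights l (?\<pi> k f)) \<le> ?M (lagrange_weights l ?a)
        + (\<Sum>j\<in>window 1. \<bar>lagrange_weights l (?\<pi> k f) j - lagrange_weights l ?a j\<bar>)"
      unfolding sum.distrib[symmetric] by (intro sum_mono) auto
    moreover have "?M (lagrange_weights l ?a) \<le> W"
      using l by (auto simp: W_def sum_nonneg)
    moreover have "K * ?N (?\<pi> k f) \<le> K * (2 * \<rho>)"
    proof -
      have "(1/2) ^ k * (2 * \<rho>) \<le> 2 * \<rho>"
        using assms(2) by (intro mult_left_le_one_le power_le_one) auto
      with tension_l1_le[OF assms(2), of k f] K0 show ?thesis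
        by (intro mult_left_mono) auto
    qed
    ultimately show ?thesis
      using K[OF l tension_in_domain[OF assms(2)], of k f] by linarith
  qed
  have uniform: "uniform_scheme 1 (geom_rule \<rho>)
      (geom_scheme \<rho> :: nat \<Rightarrow> (int \<Rightarrow> real^'n) \<Rightarrow> int \<Rightarrow> real^'n)"
    unfolding uniform_scheme_def geom_scheme_def
    by (intro allI ballI conjI refl uniform_op_pairing_ell_infty[OF _ geom_rule_eq_pairing weights])
  \<comment> \<open>Class B asks for a strictly positive constant, while \<rho> may be 0; hence the
    summand 1.\<close>
  have l1: "?N (?\<pi> k f) \<le> (1/2) ^ k * (2 * \<rho> + 1)" for k f
    by (rule order_trans[OF tension_l1_le[OF assms(2)]]) (simp add: mult_left_mono)
  have at_0: "lagrange_weights l ?a = dual_4pt l" for l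
    by (intro ext) (simp add: lagrange_weights_def dual_4pt_def)
  have conv: "convergent_scheme (\<lambda>k. uniform_op 1 (\<lambda>l. pairing 1 (lagrange_weights l ?a))
      :: (int \<Rightarrow> real^'n) \<Rightarrow> int \<Rightarrow> real^'n)"
    unfolding at_0 by (rule convergent_dual_4pt)
  have sub: "?D \<subseteq> {1..2} \<rightarrow>\<^sub>E UNIV" "?a \<in> ?D"
    using assms(2) by (auto simp: tension_domain_def field_simps)
  have M_diff: "?M (\<lambda>j\<in>window 1. lagrange_weights l x j - lagrange_weights l ?a j) \<le> K * ?N x"
    if "l \<in> {0, 1}" "x \<in> ?D" for l x
    using K[OF that] by (simp cong: sum.cong)
  show ?thesis
    unfolding class_B_def
  proof (intro exI conjI)
    show "uniform_scheme 1 (geom_rule \<rho>)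
        (geom_scheme \<rho> :: nat \<Rightarrow> (int \<Rightarrow> real^'n) \<Rightarrow> int \<Rightarrow> real^'n)"
      by (fact uniform)
    show "(2::nat) \<ge> 1" "2 * \<rho> + 1 > 0" "K > 0"
      using assms(2) K0 by auto
    show "?D \<subseteq> {1..2} \<rightarrow>\<^sub>E UNIV" "?a \<in> ?D" by (fact sub)+
    show "\<forall>k. ?\<pi> k \<in> (window 1 \<rightarrow>\<^sub>E UNIV) \<rightarrow> ?D"
      using tension_in_domain[OF assms(2)] by blast
    show "\<forall>l\<in>{0, 1}. lagrange_weights l \<in> ?D \<rightarrow> (window 1 \<rightarrow>\<^sub>E UNIV)"
      by (auto simp: lagrange_weights_def)
    show "norm_on {1..2} ?N" "norm_on (window 1) ?M"
      by (auto intro!: norm_on_l1 simp: window_def)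
    show "\<forall>l\<in>{0, 1}. \<forall>k. \<forall>f \<in> window 1 \<rightarrow>\<^sub>E UNIV.
        geom_rule \<rho> k l f = pairing 1 (lagrange_weights l (?\<pi> k f)) f"
      using geom_rule_eq_pairing by blast
    show "\<forall>k. \<forall>f \<in> window 1 \<rightarrow>\<^sub>E UNIV. ?N (?\<pi> k f) \<le> (1/2) ^ k * (2 * \<rho> + 1)"
      using l1 by blast
    show "\<forall>l\<in>{0, 1}. \<forall>x\<in>?D.
        ?M (\<lambda>j\<in>window 1. lagrange_weights l x j - lagrange_weights l ?a j) \<le> K * ?N x"
      using M_diff by blast
    show "convergent_scheme (\<lambda>k. uniform_op 1 (\<lambda>l. pairing 1 (lagrange_weights l ?a))
        :: (int \<Rightarrow> real^'n) \<Rightarrow> int \<Rightarrow> real^'n)"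
      by (fact conv)
  qed
qed

end
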